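(* Let $k\to\infty$, let $c=c(k)>0$ with $c=o(k)$, let $p=\frac{c}{k}$, and let $G=G(k)$ be a finite graph of minimum degree at least $k$. Then: (i) $G_p$ asymptotically almost surely contains a path of length at least $(1-2c^{-1/2})k$; (ii) if $G$ is bipartite, then $G_p$ asymptotically almost surely contains a path of length at least $(2-6c^{-1/2})k$; (iii) if $c\to\infty$ as $k\to\infty$, then for any fixed vertex $v=v(k)$ of $G$, asymptotically almost surely $G_p$ contains a path of length at least $(1-2c^{-1/2})k$ starting at $v$.
   Context: For a graph $G$ and $p\in[0,1]$, $G_p$ denotes the random subgraph of $G$ on the same vertex set obtained by keeping each edge of $G$ independently with probability $p$. All objects are sequences indexed by $k$, and "asymptotically almost surely" means with probability tending to $1$ as $k\to\infty$. The length of a path is its number of edges. *)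

theory Defs
  imports "HOL-Probability.Probability" "HOL-Library.Landau_Symbols"
begin

record 'a graph =
  verts :: "'a set"
  edges :: "'a set set"

text \<open>Finite simple graphs, with at least one vertex: on an empty vertex set there is no path
  at all, not even one of length 0.\<close>

definition finite_graph :: "'a graph \<Rightarrow> bool" where
  "finite_graph G \<longleftrightarrow> finite (verts G) \<and> verts G \<noteq> {} \<and>
     (\<forall>e\<in>edges G. e \<subseteq> verts G \<and> card e = 2)"

definition vert_degree :: "'a graph \<Rightarrow> 'a \<Rightarrow> nat" where
  "vert_degree G v = card {e \<in> edges G. v \<in> e}"

definition min_degree :: "'a graph \<Rightarrow> nat" where
  "min_degree G = Min (vert_degree G ` verts G)"

definition bipartite :: "'a graph \<Rightarrow> bool" where
  "bipartite G \<longleftrightarrow> (\<exists>A B. A \<union> B = verts G \<and> A \<inter> B = {} \<and>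
     (\<forall>e\<in>edges G. \<exists>a\<in>A. \<exists>b\<in>B. e = {a, b}))"

text \<open>A path is represented by its nonempty list of pairwise distinct vertices; its length is
  the number of edges, so a single vertex is a path of length 0.\<close>

definition is_path :: "'a graph \<Rightarrow> 'a list \<Rightarrow> bool" where
  "is_path G xs \<longleftrightarrow> xs \<noteq> [] \<and> set xs \<subseteq> verts G \<and> distinct xs \<and>
     successively (\<lambda>u v. {u, v} \<in> edges G) xs"

definition path_length :: "'a list \<Rightarrow> nat" where
  "path_length xs = length xs - 1"

text \<open>The law of \<open>G\<^sub>p\<close> for a graph with finitely many edges. Note that \<open>bernoulli_pmf\<close> clamps
  its parameter to the interval from 0 to 1.\<close>

definition random_subgraph :: "'a graph \<Rightarrow> real \<Rightarrow> 'a graph pmf" where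
  "random_subgraph G p =
     map_pmf (\<lambda>kept. G\<lparr>edges := {e \<in> edges G. kept e}\<rparr>)
       (Pi_pmf (edges G) False (\<lambda>_. bernoulli_pmf p))"

definition asymptotically_almost_surely :: "(nat \<Rightarrow> 'b pmf) \<Rightarrow> (nat \<Rightarrow> 'b \<Rightarrow> bool) \<Rightarrow> bool" where
  "asymptotically_almost_surely M P \<longleftrightarrow>
     (\<lambda>k. measure_pmf.prob (M k) {x. P k x}) \<longlonglongrightarrow> 1"

end

theory Submission
  imports Defs
begin

text \<open>Expose the edges of \<open>G\<^sub>p\<close> by a depth-first search. Each finished vertex has all its edges to
  undiscovered vertices exposed and absent, so if the stack never grows long, then by the time
  \<open>s = k / sqrt c\<close> vertices are finished there have been about \<open>k\<^sup>2 / c\<close> queries (twice as many if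
  \<open>G\<close> is bipartite, where only half of the stack can be adjacent to a given vertex), with \<open>k\<close>
  (respectively \<open>2 k\<close>) positive answers expected; but every positive answer discovers a vertex, and
  fewer than that have been discovered. A Chernoff bound with parameter \<open>1 / sqrt c\<close> makes this event
  exponentially unlikely in \<open>k / c\<close>. From a prescribed start vertex, the search must also survive
  until \<open>s\<close> vertices are finished, which is likely when \<open>c\<close> is large.\<close>

section \<open>Exposing one edge of the random subgraph\<close>

lemma prob_bind_bernoulli:
  assumes "0 \<le> p" "p \<le> 1"
  shows "measure_pmf.prob (bernoulli_pmf p \<bind> M) X =
         p * measure_pmf.prob (M True) X + (1 - p) * measure_pmf.prob (M False) X"
proof -
  have "ennreal (measure_pmf.prob (bernoulli_pmf p \<bind> M) X) =
        ennreal (p * measure_pmf.prob (M True) X + (1 - p) * measure_pmf.prob (M False) X)"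
    using assms
    by (simp add: measure_pmf.emeasure_eq_measure[symmetric] ennreal_mult ennreal_plus)
       (simp add: measure_pmf.emeasure_eq_measure ennreal_mult mult.commute)
  thus ?thesis
    using assms by (subst (asm) ennreal_inj) (auto intro!: add_nonneg_nonneg mult_nonneg_nonneg)
qed

text \<open>Deferred decisions: \<open>X\<close> collects the edges already found present, and
  conditioning on the next edge \<open>e\<close> either moves it into \<open>X\<close> or discards
  it.\<close>

lemma prob_Pi_bernoulli_insert:
  fixes Q :: "'e set \<Rightarrow> bool" and p :: real
  assumes "finite E" "e \<notin> E" "0 \<le> p" "p \<le> 1"
  shows "measure_pmf.prob (Pi_pmf (insert e E) False (\<lambda>_. bernoulli_pmf p))
            {f. Q (X \<union> {x \<in> insert e E. f x})} =
         p * measure_pmf.prob (Pi_pmf E False (\<lambda>_. bernoulli_pmf p)) {f. Q (insert e X \<union> {x \<in> E. f x})} +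
         (1 - p) * measure_pmf.prob (Pi_pmf E False (\<lambda>_. bernoulli_pmf p)) {f. Q (X \<union> {x \<in> E. f x})}"
proof -
  have "X \<union> {x \<in> insert e E. (f(e := True)) x} = insert e X \<union> {x \<in> E. f x}"
       "X \<union> {x \<in> insert e E. (f(e := False)) x} = X \<union> {x \<in> E. f x}" for f :: "'e \<Rightarrow> bool"
    using assms(2) by auto
  thus ?thesis
    unfolding Pi_pmf_insert'[OF assms(1,2)] prob_bind_bernoulli[OF assms(3,4)] map_pmf_def[symmetric]
      measure_map_pmf vimage_def mem_Collect_eq by simp
qed

section \<open>Neighbourhoods and degrees\<close>

definition nbhd :: "'a graph \<Rightarrow> 'a \<Rightarrow> 'a set" where
  "nbhd G v = {w. {v, w} \<in> edges G}"

lemma finite_edges: "finite_graph G \<Longrightarrow> finite (edges G)"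
  unfolding finite_graph_def by (metis Pow_iff finite_Pow_iff finite_subset subsetI)

lemma nbhd_subset: "finite_graph G \<Longrightarrow> nbhd G v \<subseteq> verts G"
  by (auto simp: finite_graph_def nbhd_def)

lemma vert_degree_eq_card_nbhd:
  assumes "finite_graph G"
  shows "vert_degree G v = card (nbhd G v)"
proof -
  have "bij_betw (\<lambda>w. {v, w}) (nbhd G v) {e \<in> edges G. v \<in> e}"
  proof (rule bij_betw_imageI)
    show "inj_on (\<lambda>w. {v, w}) (nbhd G v)"
      by (auto simp: inj_on_def doubleton_eq_iff)
    have "\<exists>w. {v, w} \<in> edges G \<and> e = {v, w}" if "e \<in> edges G" "v \<in> e" for e
    proof -
      have "card e = 2" using assms that by (auto simp: finite_graph_def)
      then obtain x y where "e = {x, y}" by (auto simp: card_2_iff)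
      thus ?thesis using that by (metis insertE insert_commute singletonD)
    qed
    thus "(\<lambda>w. {v, w}) ` nbhd G v = {e \<in> edges G. v \<in> e}"
      by (auto simp: nbhd_def)
  qed
  thus ?thesis by (simp add: vert_degree_def bij_betw_same_card)
qed

lemma card_nbhd_ge_min_degree:
  assumes "finite_graph G" "v \<in> verts G"
  shows "min_degree G \<le> card (nbhd G v)"
proof -
  have "min_degree G \<le> vert_degree G v"
    unfolding min_degree_def using assms by (intro Min_le) (auto simp: finite_graph_def)
  thus ?thesis by (simp add: vert_degree_eq_card_nbhd assms)
qed

text \<open>As \<open>A\<close> and \<open>B\<close> are disjoint, an edge between them determines
  its end in \<open>A\<close>, so counting pairs \<open>(v, w)\<close> counts no edge twice.\<close>

lemma card_edges_between_ge:
  assumes "finite A" "finite B" "A \<inter> B = {}"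
    and "\<And>v. v \<in> A \<Longrightarrow> d \<le> card (nbhd G v \<inter> B)"
    and "finite N" "\<And>v w. v \<in> A \<Longrightarrow> w \<in> B \<Longrightarrow> {v, w} \<in> edges G \<Longrightarrow> {v, w} \<in> N"
  shows "card A * d \<le> card N"
proof -
  let ?P = "SIGMA v:A. nbhd G v \<inter> B"
  have "card A * d = (\<Sum>v\<in>A. d)" by simp
  also have "\<dots> \<le> (\<Sum>v\<in>A. card (nbhd G v \<inter> B))"
    by (intro sum_mono assms)
  also have "\<dots> = card ?P"
    using assms by (subst card_SigmaI) auto
  also have "\<dots> \<le> card N"
  proof (rule card_inj_on_le)
    show "inj_on (\<lambda>(v, w). {v, w}) ?P"
      using assms(3) by (auto simp: inj_on_def doubleton_eq_iff)
    show "(\<lambda>(v, w). {v, w}) ` ?P \<subseteq> N"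
      using assms(6) by (auto simp: nbhd_def)
  qed (use assms in auto)
  finally show ?thesis .
qed

section \<open>States of the depth-first search\<close>

text \<open>A depth-first search has finished with the vertices of \<open>S\<close>, its stack is the path \<open>xs\<close>, and
  it has exposed exactly the edges of \<open>P\<close> (found present) and \<open>N\<close> (found absent).\<close>

definition dfs_state ::
  "'a graph \<Rightarrow> 'a set \<Rightarrow> 'a set \<Rightarrow> 'a list \<Rightarrow> 'a set set \<Rightarrow> 'a set set \<Rightarrow> bool" where
  "dfs_state G R S xs P N \<longleftrightarrow>
     S \<subseteq> verts G \<and> S \<inter> set xs = {} \<and>
     (xs \<noteq> [] \<longrightarrow> is_path (G\<lparr>edges := P\<rparr>) xs \<and> hd xs \<in> R) \<and>
     P \<subseteq> edges G \<and> N \<subseteq> edges G \<and> P \<inter> N = {} \<and>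
     (\<forall>e\<in>P. e \<subseteq> S \<union> set xs) \<and>
     (\<forall>v\<in>S. \<forall>w\<in>verts G - S - set xs. {v, w} \<in> edges G \<longrightarrow> {v, w} \<in> N) \<and>
     card P \<le> card S + length xs"

lemma dfs_state_init: "dfs_state G R {} [] {} {}"
  by (simp add: dfs_state_def)

lemma dfs_state_root:
  assumes "dfs_state G R S [] P N" "v \<in> R" "v \<in> verts G" "v \<notin> S"
  shows "dfs_state G R S [v] P N"
  using assms by (auto simp: dfs_state_def is_path_def)

lemma dfs_state_pop:
  assumes "dfs_state G R S (ys @ [u]) P N" "finite (verts G)"
    and "\<And>w. w \<in> verts G - S - set (ys @ [u]) \<Longrightarrow> {u, w} \<in> edges G \<Longrightarrow> {u, w} \<in> P \<union> N"
  shows "dfs_state G R (insert u S) ys P N"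
proof -
  have "u \<notin> S" "finite S"
    using assms(1,2) finite_subset by (auto simp: dfs_state_def)
  \<comment> \<open>Edges of \<open>P\<close> stay inside \<open>S\<close> and the stack, so an
    exposed edge from \<open>u\<close> to an undiscovered vertex must be absent.\<close>
  moreover have "{u, w} \<in> N" if "w \<in> verts G - S - set (ys @ [u])" "{u, w} \<in> edges G" for w
    using assms(3)[OF that] that assms(1) by (auto simp: dfs_state_def)
  ultimately show ?thesis
    using assms(1) by (auto simp: dfs_state_def is_path_def successively_append_iff hd_append split: if_splits)
qed

lemma dfs_state_absent:
  assumes "dfs_state G R S xs P N" "e \<in> edges G - P - N"
  shows "dfs_state G R S xs P (insert e N)"
  using assms by (auto simp: dfs_state_def)

text \<open>The top of the stack is the end of the list, so the head remains the root. The new edge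
  brings in the new vertex \<open>w\<close>, which preserves
  \<open>card P \<le> card S + length xs\<close>.\<close>

lemma dfs_state_present:
  assumes "dfs_state G R S (ys @ [u]) P N" "finite (edges G)" "{u, w} \<in> edges G - P - N"
    and "w \<in> verts G - S - set (ys @ [u])"
  shows "dfs_state G R S (ys @ [u, w]) (insert {u, w} P) N"
proof -
  have "finite P" using assms finite_subset by (auto simp: dfs_state_def)
  have "successively (\<lambda>x y. {x, y} \<in> insert {u, w} P) (ys @ [u])"
    using assms(1) by (auto simp: dfs_state_def is_path_def intro: successively_mono)
  hence "is_path (G\<lparr>edges := insert {u, w} P\<rparr>) (ys @ [u, w])"
    using assms by (auto simp: dfs_state_def is_path_def successively_append_iff)
  thus ?thesis
    using assms \<open>finite P\<close> by (auto simp: dfs_state_def hd_append split: if_splits)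
qed

text \<open>Of the at least \<open>k\<close> neighbours of a finished vertex, at most
  \<open>D\<close> are on the stack and at most \<open>card S\<close> are finished; the edges to all
  the others have been found absent.\<close>

lemma dfs_state_card_absent:
  assumes st: "dfs_state G R S xs P N" and fin: "finite_graph G"
    and deg: "\<And>v. v \<in> verts G \<Longrightarrow> k \<le> card (nbhd G v)"
    and D: "\<And>v. v \<in> S \<Longrightarrow> card (nbhd G v \<inter> set xs) \<le> D"
  shows "card S * (k - D - card S) \<le> card N"
proof (rule card_edges_between_ge)
  let ?B = "verts G - S - set xs"
  have V: "finite (verts G)" using fin by (simp add: finite_graph_def)
  show S: "finite S" using st V finite_subset by (auto simp: dfs_state_def)
  show "finite ?B" using V by simp
  show "finite N" using st finite_edges[OF fin] finite_subset by (auto simp: dfs_state_def)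
  show "k - D - card S \<le> card (nbhd G v \<inter> ?B)" if "v \<in> S" for v
  proof -
    have "k \<le> card (nbhd G v)" using that st by (intro deg) (auto simp: dfs_state_def)
    also have "nbhd G v = (nbhd G v \<inter> ?B) \<union> (nbhd G v \<inter> set xs) \<union> (nbhd G v \<inter> S)"
      using nbhd_subset[OF fin] by blast
    also have "card \<dots> \<le> card (nbhd G v \<inter> ?B) + card (nbhd G v \<inter> set xs) + card (nbhd G v \<inter> S)"
      by (meson add_le_mono1 card_Un_le le_trans)
    also have "card (nbhd G v \<inter> S) \<le> card S" using S by (simp add: card_mono)
    finally show ?thesis using D[OF that] by linarith
  qed
qed (use st in \<open>auto simp: dfs_state_def\<close>)

section \<open>Failure probability of the search\<close>

definition has_path_from :: "'a graph \<Rightarrow> 'a set \<Rightarrow> nat \<Rightarrow> bool" where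
  "has_path_from G R L \<longleftrightarrow> (\<exists>xs. is_path G xs \<and> hd xs \<in> R \<and> L \<le> path_length xs)"

lemma is_path_mono:
  assumes "is_path (G\<lparr>edges := F\<rparr>) xs" "F \<subseteq> F'"
  shows "is_path (G\<lparr>edges := F'\<rparr>) xs"
  using assms by (auto simp: is_path_def intro: successively_mono)

text \<open>Backward induction over the states of the search: \<open>W n q\<close> dominates the conditional
  probability of failure once \<open>n\<close> edges have been found absent and \<open>q\<close> present. The search is
  abandoned as soon as \<open>s\<close> vertices are finished; the two stopping conditions on \<open>W\<close> say that the
  bound is trivial then, and also when all roots are finished earlier.\<close>

lemma prob_no_path_from_dfs_state:
  fixes G :: "'a graph" and p :: real and W :: "nat \<Rightarrow> nat \<Rightarrow> real"
  assumes fin: "finite_graph G"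
    and deg: "\<And>v. v \<in> verts G \<Longrightarrow> k \<le> card (nbhd G v)"
    and R: "R \<subseteq> verts G"
    and p: "0 \<le> p" "p \<le> 1"
    and W_nonneg: "\<And>n q. 0 \<le> W n q"
    and W_step: "\<And>n q. p * W n (Suc q) + (1 - p) * W (Suc n) q \<le> W n q"
    and D: "\<And>xs v. is_path G xs \<Longrightarrow> path_length xs < L \<Longrightarrow> card (nbhd G v \<inter> set xs) \<le> D"
    and W_stop: "\<And>n q. s * (k - D - s) \<le> n \<Longrightarrow> q \<le> s + L \<Longrightarrow> 1 \<le> W n q"
    and W_dead: "\<And>j n q. card R \<le> j \<Longrightarrow> j < s \<Longrightarrow> j * (k - j) \<le> n \<Longrightarrow> q \<le> j \<Longrightarrow> 1 \<le> W n q"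
    and state: "dfs_state G R S xs P N" "card S \<le> s"
  shows "measure_pmf.prob (Pi_pmf (edges G - P - N) False (\<lambda>_. bernoulli_pmf p))
           {f. \<not> has_path_from (G\<lparr>edges := P \<union> {e \<in> edges G - P - N. f e}\<rparr>) R L} \<le> W (card N) (card P)"
  using state
\<comment> \<open>Undiscovered vertices have weight 2 because pushing a root lengthens the stack by
  1 without exposing an edge. An absent answer uses up an edge, and a pop shortens the
  stack.\<close>
proof (induction "card (edges G - P - N) + 2 * card (verts G - S - set xs) + length xs"
    arbitrary: S xs P N rule: less_induct)
  case less
  have V: "finite (verts G)" using fin by (simp add: finite_graph_def)
  have E: "finite (edges G)" using fin by (rule finite_edges)
  have "S \<subseteq> verts G" and disj: "S \<inter> set xs = {}"
    and PN: "P \<subseteq> edges G" "N \<subseteq> edges G"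
    and card_P: "card P \<le> card S + length xs"
    using less.prems(1) by (simp_all add: dfs_state_def)
  hence S: "finite S" and fin_PN: "finite P" "finite N"
    using V E finite_subset by blast+
  have path: "is_path (G\<lparr>edges := P\<rparr>) xs" "hd xs \<in> R" if "xs \<noteq> []"
    using less.prems(1) that by (simp_all add: dfs_state_def)
  have trivial_bound: ?case if "1 \<le> W (card N) (card P)"
    using that measure_pmf.prob_le_1 order_trans by blast
  show ?case
  \<comment> \<open>\<open>path_length []\<close> is 0, so for \<open>L = 0\<close> the empty stack
    has to be excluded explicitly.\<close>
  proof (cases "L \<le> path_length xs \<and> xs \<noteq> []")
    case True
    have "is_path (G\<lparr>edges := P \<union> {e \<in> edges G - P - N. f e}\<rparr>) xs" for f
      using path(1) True by (auto intro: is_path_mono)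
    hence "{f. \<not> has_path_from (G\<lparr>edges := P \<union> {e \<in> edges G - P - N. f e}\<rparr>) R L} = {}"
      using path(2) True by (auto simp: has_path_from_def)
    thus ?thesis using W_nonneg by simp
  next
    case short: False
    have length: "length xs \<le> L"
      using short by (cases xs) (auto simp: path_length_def)
    have D_xs: "card (nbhd G v \<inter> set xs) \<le> D" for v
    proof (cases "xs = []")
      case False
      have "is_path G xs"
        using is_path_mono[OF path(1)[OF False] PN(1)] by simp
      thus ?thesis using short False by (intro D) auto
    qed simp
    show ?thesis
    proof (cases "card S = s")
      case True
      have "s * (k - D - s) \<le> card N"
        using dfs_state_card_absent[OF less.prems(1) fin deg D_xs] True by simp
      thus ?thesis using card_P length True by (intro trivial_bound W_stop) auto
    next
      case False
      hence less_s: "card S < s" using less.prems by simp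
      show ?thesis
      proof (cases xs rule: rev_cases)
        case Nil
        show ?thesis
        proof (cases "R \<subseteq> S")
          case True
          \<comment> \<open>The stack is empty, so no neighbours are lost to it and 0 can replace
            \<open>D\<close>.\<close>
          have "card S * (k - 0 - card S) \<le> card N"
            using dfs_state_card_absent[OF less.prems(1) fin deg, of 0] Nil by simp
          thus ?thesis
            using card_P Nil less_s card_mono[OF S True]
            by (intro trivial_bound W_dead[of "card S"]) auto
        next
          case False
          then obtain v where v: "v \<in> R" "v \<notin> S" by auto
          have "verts G - S = insert v (verts G - S - {v})" using v R by auto
          hence "card (verts G - S) = Suc (card (verts G - S - {v}))"
            using V by (metis card_insert_disjoint finite_Diff Diff_iff singletonI)
          moreover have "dfs_state G R S [v] P N"
            using dfs_state_root[of G R S P N v] less.prems(1) Nil v R by auto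
          moreover have "verts G - S - set [v] = verts G - S - {v}" "verts G - S - set xs = verts G - S"
            using Nil by simp_all
          ultimately show ?thesis
            using less.prems(2) Nil by (intro less.hyps[of P N S "[v]"]) simp_all
        qed
      next
        case (snoc ys u)
        show ?thesis
        proof (cases "\<exists>w. w \<in> verts G - S - set xs \<and> {u, w} \<in> edges G - P - N")
          case True
          then obtain w where w: "w \<in> verts G - S - set xs" "{u, w} \<in> edges G - P - N" by blast
          let ?e = "{u, w}"
          have E': "edges G - P - N = insert ?e (edges G - insert ?e P - N)"
                   "edges G - P - insert ?e N = edges G - insert ?e P - N"
            using w by auto
          have card_E': "card (edges G - P - N) = Suc (card (edges G - insert ?e P - N))"
            unfolding E'(1) using E by (subst card_insert_disjoint) auto
          have "verts G - S - set xs = insert w (verts G - S - set (ys @ [u, w]))"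
            using w snoc by auto
          hence card_V': "card (verts G - S - set xs) = Suc (card (verts G - S - set (ys @ [u, w])))"
            using V by simp
          have "measure_pmf.prob (Pi_pmf (edges G - insert ?e P - N) False (\<lambda>_. bernoulli_pmf p))
             {f. \<not> has_path_from (G\<lparr>edges := insert ?e P \<union> {e \<in> edges G - insert ?e P - N. f e}\<rparr>) R L}
               \<le> W (card N) (card (insert ?e P))"
          proof (rule less.hyps)
            show "dfs_state G R S (ys @ [u, w]) (insert ?e P) N"
              using less.prems(1) snoc E w by (intro dfs_state_present) simp_all
            show "card S \<le> s" by fact
            show "card (edges G - insert ?e P - N) + 2 * card (verts G - S - set (ys @ [u, w])) +
                length (ys @ [u, w])
              < card (edges G - P - N) + 2 * card (verts G - S - set xs) + length xs"
              unfolding card_E' card_V' using snoc by simp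
          qed
          moreover have "measure_pmf.prob (Pi_pmf (edges G - P - insert ?e N) False (\<lambda>_. bernoulli_pmf p))
             {f. \<not> has_path_from (G\<lparr>edges := P \<union> {e \<in> edges G - P - insert ?e N. f e}\<rparr>) R L}
               \<le> W (card (insert ?e N)) (card P)"
          proof (rule less.hyps)
            show "dfs_state G R S xs P (insert ?e N)"
              using less.prems(1) w by (intro dfs_state_absent)
            show "card S \<le> s" by fact
            show "card (edges G - P - insert ?e N) + 2 * card (verts G - S - set xs) + length xs
              < card (edges G - P - N) + 2 * card (verts G - S - set xs) + length xs"
              unfolding E'(2) card_E' by simp
          qed
          \<comment> \<open>Conditioning on the answer for \<open>?e\<close> averages the two
            induction hypotheses; \<open>W_step\<close> then bounds the average.\<close>
          ultimately have "measure_pmf.prob (Pi_pmf (edges G - P - N) False (\<lambda>_. bernoulli_pmf p))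
             {f. \<not> has_path_from (G\<lparr>edges := P \<union> {e \<in> edges G - P - N. f e}\<rparr>) R L}
               \<le> p * W (card N) (Suc (card P)) + (1 - p) * W (Suc (card N)) (card P)"
            unfolding E' using w E p fin_PN
            by (subst prob_Pi_bernoulli_insert[where Q = "\<lambda>F. \<not> has_path_from (G\<lparr>edges := F\<rparr>) R L"])
               (auto intro!: add_mono mult_left_mono)
          thus ?thesis using W_step[of "card N" "card P"] by linarith
        next
          case False
          \<comment> \<open>All edges from \<open>u\<close> to undiscovered vertices have been
            exposed, so \<open>u\<close> is finished and popped.\<close>
          have u: "u \<notin> S" using disj snoc by auto
          have "dfs_state G R (insert u S) ys P N"
            using False snoc less.prems V by (intro dfs_state_pop) auto
          moreover have "verts G - insert u S - set ys = verts G - S - set xs"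
            using snoc by auto
          ultimately show ?thesis
            using less_s u S snoc by (intro less.hyps[where xs = ys and S = "insert u S"]) auto
        qed
      qed
    qed
  qed
qed

lemma prob_random_subgraph_no_path_le:
  fixes G :: "'a graph" and p :: real and W :: "nat \<Rightarrow> nat \<Rightarrow> real"
  assumes fin: "finite_graph G"
    and deg: "k \<le> min_degree G"
    and R: "R \<subseteq> verts G"
    and p: "0 \<le> p" "p \<le> 1"
    and W_nonneg: "\<And>n q. 0 \<le> W n q"
    and W_step: "\<And>n q. p * W n (Suc q) + (1 - p) * W (Suc n) q \<le> W n q"
    and D: "\<And>xs v. is_path G xs \<Longrightarrow> path_length xs < L \<Longrightarrow> card (nbhd G v \<inter> set xs) \<le> D"
    and W_stop: "\<And>n q. s * (k - D - s) \<le> n \<Longrightarrow> q \<le> s + L \<Longrightarrow> 1 \<le> W n q"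
    and W_dead: "\<And>j n q. card R \<le> j \<Longrightarrow> j < s \<Longrightarrow> j * (k - j) \<le> n \<Longrightarrow> q \<le> j \<Longrightarrow> 1 \<le> W n q"
  shows "measure_pmf.prob (random_subgraph G p) {H. \<not> has_path_from H R L} \<le> W 0 0"
proof -
  have "k \<le> card (nbhd G v)" if "v \<in> verts G" for v
    using card_nbhd_ge_min_degree[OF fin that] deg by simp
  from prob_no_path_from_dfs_state[where W = W and s = s and S = "{}" and xs = "[]" and P = "{}" and N = "{}",
      OF fin this R p W_nonneg W_step D W_stop W_dead dfs_state_init]
  show ?thesis by (simp add: random_subgraph_def measure_map_pmf vimage_def)
qed

section \<open>Neighbours on a path in a bipartite graph\<close>

text \<open>Cut the list into consecutive pairs: each contains at most one element of
  \<open>C\<close>, and a leftover entry accounts for the rounding up.\<close>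

lemma card_Int_path_le:
  assumes "successively (\<lambda>u w. \<not> (u \<in> C \<and> w \<in> C)) xs"
  shows "card (C \<inter> set xs) \<le> (length xs + 1) div 2"
  using assms
proof (induction xs rule: induct_list012)
  case (2 x)
  show ?case by (cases "x \<in> C") auto
next
  case (3 x y zs)
  have "C \<inter> set (x # y # zs) \<subseteq> insert (if x \<in> C then x else y) (C \<inter> set zs)"
    using 3(3) by auto
  hence "card (C \<inter> set (x # y # zs)) \<le> card (insert (if x \<in> C then x else y) (C \<inter> set zs))"
    by (intro card_mono) auto
  also have "\<dots> \<le> Suc (card (C \<inter> set zs))" by (simp add: card_insert_if)
  finally have "card (C \<inter> set (x # y # zs)) \<le> Suc (card (C \<inter> set zs))" .
  moreover have "card (C \<inter> set zs) \<le> (length zs + 1) div 2"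
    using 3(3) by (intro 3(1)) (cases zs; simp)
  moreover have "(length (x # y # zs) + 1) div 2 = Suc ((length zs + 1) div 2)" by simp
  ultimately show ?case by linarith
qed simp

text \<open>Both \<open>u\<close> and \<open>w\<close> lie on the side opposite to \<open>v\<close>.
  Hence two consecutive vertices of a path are never both neighbours of \<open>v\<close>.\<close>

lemma bipartite_triangle_free:
  assumes "bipartite G" "{v, u} \<in> edges G" "{v, w} \<in> edges G"
  shows "{u, w} \<notin> edges G"
proof
  assume "{u, w} \<in> edges G"
  obtain A B where AB: "A \<inter> B = {}" "\<forall>e\<in>edges G. \<exists>a\<in>A. \<exists>b\<in>B. e = {a, b}"
    using assms(1) by (auto simp: bipartite_def)
  have "(x \<in> A \<and> y \<in> B) \<or> (x \<in> B \<and> y \<in> A)" if "{x, y} \<in> edges G" for x y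
    using AB(2)[rule_format, OF that] by (auto simp: doubleton_eq_iff)
  from this[OF assms(2)] this[OF assms(3)] this[OF \<open>{u, w} \<in> edges G\<close>]
  show False using AB(1) by auto
qed

lemma bipartite_card_nbhd_path_le:
  assumes "bipartite G" "is_path G xs"
  shows "card (nbhd G v \<inter> set xs) \<le> (length xs + 1) div 2"
proof (rule card_Int_path_le)
  have "successively (\<lambda>u w. {u, w} \<in> edges G) xs"
    using assms(2) by (simp add: is_path_def)
  thus "successively (\<lambda>u w. \<not> (u \<in> nbhd G v \<and> w \<in> nbhd G v)) xs"
    by (rule successively_mono) (auto simp: nbhd_def dest: bipartite_triangle_free[OF assms(1)])
qed

section \<open>Chernoff bound along the search\<close>

text \<open>The quadratic Taylor polynomial of \<open>exp t\<close>, a lower bound for it, times the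
  claimed right-hand side equals \<open>1 + t^4 / 4\<close>, which is at least 1.\<close>

lemma exp_minus_le_quadratic:
  fixes t :: real
  assumes "0 \<le> t"
  shows "exp (- t) \<le> 1 - t + t\<^sup>2 / 2"
proof -
  have pos: "0 \<le> 1 - t + t\<^sup>2 / 2"
    using zero_le_power2[of "t - 1"] by (simp add: power2_eq_square algebra_simps)
  have "1 \<le> 1 + (t\<^sup>2)\<^sup>2 / 4" by simp
  also have "\<dots> = (1 + t + t\<^sup>2 / 2) * (1 - t + t\<^sup>2 / 2)"
    by (simp add: power2_eq_square algebra_simps)
  also have "\<dots> \<le> exp t * (1 - t + t\<^sup>2 / 2)"
    using exp_lower_Taylor_quadratic[OF assms] pos by (intro mult_right_mono) auto
  finally show ?thesis by (simp add: exp_minus field_simps)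
qed

text \<open>Each query multiplies the weight by \<open>exp y\<close>, and a positive answer also by
  \<open>exp (- t)\<close>. The expected factor is \<open>exp y * (1 - y)\<close>, at most
  1.\<close>

lemma chernoff_weight_step:
  fixes p t M N x y :: real
  assumes "0 \<le> p" "p \<le> 1"
  defines "y \<equiv> p * (1 - exp (- t))"
  shows "p * exp (t * (M - (q + 1)) - y * (N - n - (q + 1))) + (1 - p) * exp (t * (M - q) - y * (N - (n + 1) - q))
           \<le> exp (t * (M - q) - y * (N - n - q))" (is "?lhs \<le> ?rhs")
proof -
  have present: "exp (t * (M - (q + 1)) - y * (N - n - (q + 1))) = ?rhs * exp y * exp (- t)"
    unfolding exp_add[symmetric] by (simp add: algebra_simps)
  have absent: "exp (t * (M - q) - y * (N - (n + 1) - q)) = ?rhs * exp y"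
    unfolding exp_add[symmetric] by (simp add: algebra_simps)
  have "p * (A * exp (- t)) + (1 - p) * A = A * (1 - y)" for A
    unfolding y_def by (simp add: algebra_simps)
  hence "?lhs = ?rhs * exp y * (1 - y)"
    unfolding present absent .
  also have "\<dots> \<le> ?rhs * exp y * exp (- y)"
    using exp_ge_add_one_self[of "- y"] by (intro mult_left_mono) auto
  also have "\<dots> = ?rhs" by (simp add: exp_minus)
  finally show ?thesis .
qed

lemma path_length_less_iff: "xs \<noteq> [] \<Longrightarrow> path_length xs < L \<longleftrightarrow> length xs \<le> L"
  by (cases xs) (auto simp: path_length_def)

text \<open>Shared by all three cases: up to rounding, \<open>\<mu> * k\<close> positive answers are
  expected among the absent queries counted by \<open>absent\<close>, with \<open>\<mu> = 1\<close>
  in general and \<open>\<mu> = 2\<close> for bipartite graphs. The Chernoff weight pays for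
  stopping with \<open>s\<close> finished vertices, and \<open>V\<close> for exhausting the roots
  earlier.\<close>

lemma prob_no_long_path_le:
  fixes G :: "'a graph" and c \<mu> :: real and V :: "nat \<Rightarrow> nat \<Rightarrow> real"
  defines "s \<equiv> \<lambda>c k. nat \<lfloor>real k / sqrt c\<rfloor>"
  assumes fin: "finite_graph G" and deg: "k \<le> min_degree G" and R: "R \<subseteq> verts G"
    and c: "4 \<le> c" "c \<le> real k"
    and D: "\<And>xs v. is_path G xs \<Longrightarrow> path_length xs < L \<Longrightarrow> card (nbhd G v \<inter> set xs) \<le> D"
    and absent: "\<mu> * real k - 3 * sqrt c \<le> c / real k * real (s c k * (k - D - s c k))"
    and present: "real (s c k + L) \<le> (\<mu> - (\<mu> + 1) / (2 * sqrt c)) * real k + 1"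
    and V_nonneg: "\<And>n q. 0 \<le> V n q"
    and V_step: "\<And>n q. c / real k * V n (Suc q) + (1 - c / real k) * V (Suc n) q \<le> V n q"
    and V_dead: "\<And>j n q. card R \<le> j \<Longrightarrow> j < s c k \<Longrightarrow> j * (k - j) \<le> n \<Longrightarrow> q \<le> j \<Longrightarrow> 1 \<le> V n q"
  shows "measure_pmf.prob (random_subgraph G (c / real k)) {H. \<not> has_path_from H R L}
           \<le> exp (4 - real k / (2 * c)) + V 0 0"
proof -
  define p where "p = c / real k"
  define t where "t = 1 / sqrt c"
  define y where "y = p * (1 - exp (- t))"
  define M where "M = s c k + L"
  define N where "N = s c k * (k - D - s c k)"
  define w where "w = (\<lambda>n q. exp (t * (real M - q) - y * (real N - n - q)))"
  define W where "W = (\<lambda>n q. w (real n) (real q) + V n q)"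
  have p: "0 \<le> p" "p \<le> 1" using c by (auto simp: p_def)
  have r: "2 \<le> sqrt c" using c real_sqrt_le_mono[of 4 c] by simp
  have t: "0 \<le> t" "t \<le> 1" using r c by (auto simp: t_def divide_le_eq_1)
  have y: "0 \<le> y" using p t by (auto simp: y_def)
  have "measure_pmf.prob (random_subgraph G p) {H. \<not> has_path_from H R L} \<le> W 0 0"
  proof (rule prob_random_subgraph_no_path_le[where W = W and s = "s c k", OF fin deg R p _ _ D])
    show "0 \<le> W n q" for n q using V_nonneg by (simp add: W_def w_def add_nonneg_nonneg)
    show "p * W n (Suc q) + (1 - p) * W (Suc n) q \<le> W n q" for n q
    proof -
      have "p * w (real n) (real q + 1) + (1 - p) * w (real n + 1) (real q) \<le> w (real n) (real q)"
        unfolding w_def y_def by (rule chernoff_weight_step[OF p])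
      from add_mono[OF this V_step[of n q]] show ?thesis
        by (simp only: W_def p_def of_nat_Suc distrib_left add_ac)
    qed
    \<comment> \<open>On stopping there are at most \<open>M\<close> positive answers and at least
      \<open>N\<close> queries, so both terms of the exponent are nonnegative.\<close>
    show "1 \<le> W n q" if "s c k * (k - D - s c k) \<le> n" "q \<le> s c k + L" for n q
    proof -
      have "0 \<le> t * (real M - real q)" using t that by (simp add: M_def)
      moreover have "0 \<le> y * (real n + real q - real N)"
      proof -
        have "N \<le> n + q" using that(1) by (simp add: N_def)
        hence "real N \<le> real n + real q" by linarith
        thus ?thesis using y by simp
      qed
      ultimately have "1 \<le> w (real n) (real q)"
        by (simp add: w_def algebra_simps)
      thus ?thesis using V_nonneg[of n q] by (simp add: W_def)
    qed
    show "1 \<le> W n q" if "card R \<le> j" "j < s c k" "j * (k - j) \<le> n" "q \<le> j" for j n q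
      using V_dead[OF that] by (simp add: W_def w_def add_increasing)
  qed
  moreover
  have "t * real M - y * real N \<le> 4 - real k / (2 * c)"
  proof -
    let ?u = "t - t\<^sup>2 / 2"
    have "t * t \<le> t" using t by (simp add: mult_left_le)
    hence u: "0 \<le> ?u" using t(1) by (simp add: power2_eq_square)
    have "?u * (\<mu> * real k - 3 * sqrt c) \<le> ?u * (p * real N)"
      using absent u by (intro mult_left_mono) (auto simp: p_def N_def)
    also have "\<dots> = (p * real N) * ?u" by simp
    also have "\<dots> \<le> (p * real N) * (1 - exp (- t))"
      using exp_minus_le_quadratic[OF t(1)] p by (intro mult_left_mono) auto
    also have "\<dots> = y * real N" by (simp add: y_def)
    finally have "?u * (\<mu> * real k - 3 * sqrt c) \<le> y * real N" .
    moreover have "t * real M \<le> t * ((\<mu> - (\<mu> + 1) / (2 * sqrt c)) * real k + 1)"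
      using present t by (intro mult_left_mono) (auto simp: M_def)
    \<comment> \<open>With \<open>t = 1 / sqrt c\<close> the main terms
      \<open>\<mu> * k / sqrt c\<close> cancel. The slack in \<open>present\<close> gains
      \<open>(\<mu> + 1) * k / (2 * c)\<close>, the quadratic term of \<open>?u\<close> costs
      \<open>\<mu> * k / (2 * c)\<close>, and \<open>k / (2 * c)\<close> remains.\<close>
    moreover have "t * ((\<mu> - (\<mu> + 1) / (2 * sqrt c)) * real k + 1) - ?u * (\<mu> * real k - 3 * sqrt c)
                   = 3 - t / 2 - real k / (2 * c)"
    proof -
      have "1 / r * ((\<mu> - (\<mu> + 1) / (2 * r)) * x + 1) - (1 / r - (1 / r)\<^sup>2 / 2) * (\<mu> * x - 3 * r)
          = 3 - 1 / r / 2 - x / (2 * (r * r))" if "r \<noteq> 0" for r x :: real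
        using that by (simp add: field_simps power2_eq_square)
      from this[of "sqrt c" "real k"] have "sqrt c \<noteq> 0 \<Longrightarrow> ?thesis"
        unfolding t_def real_sqrt_mult_self using c by simp
      thus ?thesis using c by simp
    qed
    ultimately show ?thesis using t by linarith
  qed
  hence "exp (t * real M - y * real N) \<le> exp (4 - real k / (2 * c))" by simp
  moreover have "W 0 0 = exp (t * real M - y * real N) + V 0 0" by (simp add: W_def w_def)
  ultimately show ?thesis unfolding p_def by linarith
qed

section \<open>Failure bounds for fixed \<open>k\<close> in the three cases\<close>

text \<open>When every vertex is a root, this keeps the roots from running out before
  \<open>s \<le> k\<close> vertices are finished, so \<open>V = 0\<close> is admissible.\<close>

lemma le_card_verts_if_min_degree:
  assumes "finite_graph G" "k \<le> min_degree G"
  shows "k \<le> card (verts G)"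
proof -
  obtain v where "v \<in> verts G" using assms(1) by (auto simp: finite_graph_def)
  hence "k \<le> card (nbhd G v)" using card_nbhd_ge_min_degree[OF assms(1)] assms(2) le_trans by blast
  also have "\<dots> \<le> card (verts G)"
    using assms(1) nbhd_subset[OF assms(1)] by (intro card_mono) (simp_all add: finite_graph_def)
  finally show ?thesis .
qed

text \<open>To be read with \<open>K = k\<close>, \<open>r = sqrt c\<close> and
  \<open>x = \<mu>\<close>: \<open>s\<close> finished vertices with \<open>d\<close> absent edges
  each. The two roundings by 1 cost \<open>(x + 1) * r\<close> in the expected number of positive
  answers.\<close>

lemma absent_queries_ge:
  fixes K r s d x y :: real
  assumes "2 \<le> r" "r\<^sup>2 \<le> K" "K / r - 1 \<le> s" "x * (K / r) - 1 \<le> d" "1 \<le> x"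
  shows "x * K - (x + 1) * r \<le> r\<^sup>2 / K * (s * d)"
proof -
  have "r * 1 \<le> r * r" using assms(1) by (intro mult_left_mono) auto
  hence "r \<le> K" using assms(2) by (simp add: power2_eq_square)
  hence "0 < K" using assms(1) by linarith
  have q: "1 \<le> K / r" using assms(1) \<open>r \<le> K\<close> by (simp add: le_divide_eq)
  have "K / r * 1 \<le> K / r * x" using q assms(5) by (intro mult_left_mono) auto
  hence q': "1 \<le> x * (K / r)" using q by (simp add: mult.commute)
  have "(K / r - 1) * (x * (K / r) - 1) \<le> s * d"
    using assms(3,4) q q' by (intro mult_mono) linarith+
  hence "r\<^sup>2 / K * ((K / r - 1) * (x * (K / r) - 1)) \<le> r\<^sup>2 / K * (s * d)"
    using \<open>0 < K\<close> by (intro mult_left_mono) auto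
  moreover have "r\<^sup>2 / K * ((K / r - 1) * (x * (K / r) - 1)) = x * K - (x + 1) * r + r\<^sup>2 / K"
    using assms(1) \<open>0 < K\<close> by (simp add: field_simps power2_eq_square)
  moreover have "0 \<le> r\<^sup>2 / K" using \<open>0 < K\<close> by simp
  ultimately show ?thesis by linarith
qed

lemma finished_bounds:
  fixes k :: nat and c :: real
  assumes "0 < c"
  shows "real k / sqrt c - 1 \<le> real (nat \<lfloor>real k / sqrt c\<rfloor>)"
    "real (nat \<lfloor>real k / sqrt c\<rfloor>) \<le> real k / sqrt c"
proof -
  have "0 \<le> real k / sqrt c" using assms by simp
  thus "real k / sqrt c - 1 \<le> real (nat \<lfloor>real k / sqrt c\<rfloor>)"
    "real (nat \<lfloor>real k / sqrt c\<rfloor>) \<le> real k / sqrt c"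
    by linarith+
qed

lemma card_nbhd_path_le:
  assumes "path_length xs < L"
  shows "card (nbhd G v \<inter> set xs) \<le> L"
proof (cases "xs = []")
  case False
  hence "length xs \<le> L" using assms by (simp add: path_length_less_iff)
  moreover have "card (nbhd G v \<inter> set xs) \<le> card (set xs)" by (intro card_mono) auto
  moreover have "card (set xs) \<le> length xs" by (rule card_length)
  ultimately show ?thesis by linarith
qed simp

lemma prob_no_path_from_le:
  fixes G :: "'a graph" and c :: real and V :: "nat \<Rightarrow> nat \<Rightarrow> real"
  assumes "finite_graph G" "k \<le> min_degree G" "R \<subseteq> verts G"
    and c: "4 \<le> c" "c \<le> real k"
    and V_nonneg: "\<And>n q. 0 \<le> V n q"
    and V_step: "\<And>n q. c / real k * V n (Suc q) + (1 - c / real k) * V (Suc n) q \<le> V n q"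
    and V_dead: "\<And>j n q. card R \<le> j \<Longrightarrow> j < nat \<lfloor>real k / sqrt c\<rfloor> \<Longrightarrow> j * (k - j) \<le> n \<Longrightarrow> q \<le> j
                   \<Longrightarrow> 1 \<le> V n q"
  shows "measure_pmf.prob (random_subgraph G (c / real k))
           {H. \<not> has_path_from H R (nat \<lceil>(1 - 2 / sqrt c) * real k\<rceil>)}
           \<le> exp (4 - real k / (2 * c)) + V 0 0"
proof -
  define L where "L = nat \<lceil>(1 - 2 / sqrt c) * real k\<rceil>"
  define s where "s = nat \<lfloor>real k / sqrt c\<rfloor>"
  define z where "z = real k / sqrt c"
  have r: "2 \<le> sqrt c" using c real_sqrt_le_mono[of 4 c] by simp
  have "0 \<le> (1 - 2 / sqrt c) * real k" using r c by (intro mult_nonneg_nonneg) (auto simp: divide_le_eq)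
  hence "real L \<le> (1 - 2 / sqrt c) * real k + 1" unfolding L_def by linarith
  hence L: "real L \<le> real k - 2 * z + 1" by (simp add: z_def left_diff_distrib)
  have s: "z - 1 \<le> s" "s \<le> z"
    unfolding z_def s_def using finished_bounds[of c k] c by linarith+
  have "(1 - (1 + 1) / (2 * sqrt c)) * real k + 1 = real k - z + 1"
    by (simp add: z_def left_diff_distrib)
  hence present: "real (s + L) \<le> (1 - (1 + 1) / (2 * sqrt c)) * real k + 1"
    using L s(2) by linarith
  \<comment> \<open>Up to rounding, the stack takes at most \<open>k - 2 * z\<close> neighbours and
    the finished vertices at most \<open>z\<close>, which leaves \<open>z\<close>.\<close>
  have "1 * z - 1 \<le> real (k - L - s)"
    using L s(2) by linarith
  from absent_queries_ge[OF r _ s(1)[unfolded z_def] this[unfolded z_def]] c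
  have "1 * real k - 2 * sqrt c \<le> c / real k * real (s * (k - L - s))" by simp
  hence absent: "1 * real k - 3 * sqrt c \<le> c / real k * real (s * (k - L - s))"
    using r by linarith
  show ?thesis
    using prob_no_long_path_le[where V = V, OF assms(1-3) c card_nbhd_path_le
        absent[unfolded s_def] present[unfolded s_def] V_nonneg V_step V_dead]
    unfolding L_def .
qed

lemma bipartite_prob_no_path_le:
  fixes G :: "'a graph" and c :: real
  assumes "finite_graph G" "k \<le> min_degree G" "bipartite G"
    and c: "9 \<le> c" "c \<le> real k"
  shows "measure_pmf.prob (random_subgraph G (c / real k))
           {H. \<not> has_path_from H (verts G) (nat \<lceil>(2 - 6 / sqrt c) * real k\<rceil>)}
           \<le> exp (4 - real k / (2 * c))"
proof -
  define L where "L = nat \<lceil>(2 - 6 / sqrt c) * real k\<rceil>"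
  define D where "D = (L + 1) div 2"
  define s where "s = nat \<lfloor>real k / sqrt c\<rfloor>"
  define z where "z = real k / sqrt c"
  have c4: "4 \<le> c" using c by simp
  have r: "3 \<le> sqrt c" using c real_sqrt_le_mono[of 9 c] by simp
  have z: "0 \<le> z" "z \<le> real k"
    using r c by (simp_all add: z_def divide_le_eq mult_le_cancel_left1)
  have "0 \<le> (2 - 6 / sqrt c) * real k" using r c by (intro mult_nonneg_nonneg) (auto simp: divide_le_eq)
  hence "real L \<le> (2 - 6 / sqrt c) * real k + 1" unfolding L_def by linarith
  hence L: "real L \<le> 2 * real k - 6 * z + 1" by (simp add: z_def left_diff_distrib)
  have "2 * D \<le> L + 1" by (simp add: D_def)
  hence D: "real D \<le> real k - 3 * z + 1" using L by linarith
  have s: "z - 1 \<le> s" "s \<le> z"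
    unfolding z_def s_def using finished_bounds[of c k] c by linarith+
  have "(2 - (2 + 1) / (2 * sqrt c)) * real k + 1 = 2 * real k - 3 / 2 * z + 1"
    by (simp add: z_def left_diff_distrib)
  hence present: "real (s + L) \<le> (2 - (2 + 1) / (2 * sqrt c)) * real k + 1"
    using L s(2) z by linarith
  \<comment> \<open>Only half of the stack counts, about \<open>k - 3 * z\<close>; the finished
    vertices take \<open>z\<close> more, which leaves \<open>2 * z\<close>. This is the source of
    the constant 6.\<close>
  have "2 * z - 1 \<le> real (k - D - s)"
    using D s(2) by linarith
  from absent_queries_ge[OF _ _ s(1)[unfolded z_def] this[unfolded z_def]] c r
  have absent: "2 * real k - 3 * sqrt c \<le> c / real k * real (s * (k - D - s))" by simp
  have path: "card (nbhd G v \<inter> set xs) \<le> D" if "is_path G xs" "path_length xs < L" for xs v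
  proof -
    have "xs \<noteq> []" using that by (auto simp: is_path_def)
    hence "length xs \<le> L" using that path_length_less_iff by blast
    hence "(length xs + 1) div 2 \<le> D" unfolding D_def by (intro div_le_mono) simp
    thus ?thesis using bipartite_card_nbhd_path_le[OF assms(3) that(1), of v] by linarith
  qed
  have "s \<le> card (verts G)"
    using s(2) z(2) le_card_verts_if_min_degree[OF assms(1,2)] by linarith
  thus ?thesis
    using prob_no_long_path_le[where V = "\<lambda>_ _. 0", OF assms(1,2) order_refl c4 c(2) path
        absent[unfolded s_def] present[unfolded s_def]]
    unfolding L_def s_def by simp
qed

lemma prob_no_path_le:
  fixes G :: "'a graph" and c :: real
  assumes "finite_graph G" "k \<le> min_degree G"
    and c: "4 \<le> c" "c \<le> real k"
  shows "measure_pmf.prob (random_subgraph G (c / real k))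
           {H. \<not> has_path_from H (verts G) (nat \<lceil>(1 - 2 / sqrt c) * real k\<rceil>)}
           \<le> exp (4 - real k / (2 * c))"
proof -
  let ?s = "nat \<lfloor>real k / sqrt c\<rfloor>"
  have r: "2 \<le> sqrt c" using c real_sqrt_le_mono[of 4 c] by simp
  have "real k / sqrt c \<le> real k" using r c by (simp add: divide_le_eq mult_le_cancel_left1)
  hence "?s \<le> card (verts G)"
    using finished_bounds(2)[of c k] c le_card_verts_if_min_degree[OF assms(1,2)] by linarith
  thus ?thesis
    using prob_no_path_from_le[where V = "\<lambda>_ _. 0", OF assms(1,2) order_refl c] by simp
qed

text \<open>The probability that the component of \<open>v\<close> is exhausted early: an exploration finishing \<open>j\<close>
  vertices finds at most \<open>j\<close> edges present and \<open>j (k - j)\<close> absent. The weight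
  \<open>b ^ n / a ^ Suc q\<close> is a supermartingale which is at least 1 on all of these events.\<close>

lemma prob_no_path_from_vertex_le:
  fixes G :: "'a graph" and c :: real
  assumes "finite_graph G" "k \<le> min_degree G" "v \<in> verts G"
    and c: "12 \<le> c" "c \<le> real k"
  shows "measure_pmf.prob (random_subgraph G (c / real k))
           {H. \<not> has_path_from H {v} (nat \<lceil>(1 - 2 / sqrt c) * real k\<rceil>)}
           \<le> exp (4 - real k / (2 * c)) + 1 / sqrt (1 + c / 4)"
proof -
  define p where "p = c / real k"
  define a where "a = sqrt (1 + c / 4)"
  define b where "b = 1 + p * (1 - 1 / a)"
  let ?s = "nat \<lfloor>real k / sqrt c\<rfloor>"
  have r: "2 \<le> sqrt c" using c real_sqrt_le_mono[of 4 c] by simp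
  have p: "0 \<le> p" "p \<le> 1" using c by (auto simp: p_def)
  \<comment> \<open>The threshold 12 on \<open>c\<close> is what makes \<open>1 + c / 4\<close> at
    least 4.\<close>
  have a: "2 \<le> a" using c real_sqrt_le_mono[of 4 "1 + c / 4"] by (simp add: a_def)
  have a2: "a\<^sup>2 = 1 + c / 4" using c by (simp add: a_def)
  have half: "1 / 2 \<le> 1 - 1 / a" using a by (simp add: field_simps)
  have x: "0 \<le> p * (1 - 1 / a)" using p half by simp
  have "measure_pmf.prob (random_subgraph G (c / real k))
           {H. \<not> has_path_from H {v} (nat \<lceil>(1 - 2 / sqrt c) * real k\<rceil>)}
           \<le> exp (4 - real k / (2 * c)) + b ^ 0 / a ^ Suc 0"
  proof (rule prob_no_path_from_le[where V = "\<lambda>n q. b ^ n / a ^ Suc q", OF assms(1,2)])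
    show "{v} \<subseteq> verts G" "4 \<le> c" "c \<le> real k" using assms by auto
    show "0 \<le> b ^ n / a ^ Suc q" for n q using a x by (simp add: b_def)
    show "c / real k * (b ^ n / a ^ Suc (Suc q)) + (1 - c / real k) * (b ^ Suc n / a ^ Suc q)
            \<le> b ^ n / a ^ Suc q" for n q
    proof -
      \<comment> \<open>\<open>b\<close> is chosen so that the expected factor of one query falls
        short of 1 only by a term of order \<open>p^2\<close>.\<close>
      have "p / a + (1 - p) * b = 1 - p * (p * (1 - 1 / a))"
        using a by (simp add: b_def field_simps)
      also have "\<dots> \<le> 1" using p x by simp
      finally have "b ^ n / a ^ Suc q * (p / a + (1 - p) * b) \<le> b ^ n / a ^ Suc q * 1"
        using a x by (intro mult_left_mono) (auto simp: b_def)
      moreover have "b ^ n / a ^ Suc q * (p / a + (1 - p) * b)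
          = p * (b ^ n / a ^ Suc (Suc q)) + (1 - p) * (b ^ Suc n / a ^ Suc q)"
        using a by (simp add: field_simps)
      ultimately show ?thesis by (simp add: p_def)
    qed
    show "1 \<le> b ^ n / a ^ Suc q"
      if "card {v} \<le> j" "j < ?s" "j * (k - j) \<le> n" "q \<le> j" for j n q
    proof -
      have k: "0 < real k" using c by linarith
      \<comment> \<open>While \<open>j\<close> is at most \<open>k / 2\<close>, a finished vertex
        has at least \<open>k / 2\<close> absent edges, and by Bernoulli's inequality these
        contribute a factor of at least \<open>1 + c / 4 = a^2\<close>.\<close>
      have "real k / sqrt c \<le> real k / 2" using r c by (intro divide_left_mono) auto
      hence "real j \<le> real k / 2"
        using finished_bounds(2)[of c k] c that(2) by linarith
      hence "real k / 2 \<le> real (k - j)" by linarith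
      hence "real k / 2 * (p * (1 / 2)) \<le> real (k - j) * (p * (1 - 1 / a))"
        using p half x by (intro mult_mono mult_left_mono) auto
      moreover have "real k / 2 * (p * (1 / 2)) = c / 4" using k by (simp add: p_def)
      moreover have "1 + real (k - j) * (p * (1 - 1 / a)) \<le> b ^ (k - j)"
        unfolding b_def using x by (intro Bernoulli_inequality) linarith
      ultimately have "a\<^sup>2 \<le> b ^ (k - j)" using a2 by linarith
      \<comment> \<open>\<open>Suc q \<le> 2 * j\<close> because the root itself is finished, so
        \<open>j\<close> is at least 1. The spare factor \<open>a\<close> in the weight makes its
        initial value \<open>1 / a\<close>.\<close>
      have "a ^ Suc q \<le> a ^ (2 * j)"
        using a that by (intro power_increasing) auto
      also have "\<dots> = (a\<^sup>2) ^ j" by (simp add: power_mult)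
      also have "\<dots> \<le> (b ^ (k - j)) ^ j"
        using \<open>a\<^sup>2 \<le> b ^ (k - j)\<close> by (intro power_mono) auto
      also have "\<dots> = b ^ (j * (k - j))" by (simp add: power_mult[symmetric] mult.commute)
      also have "\<dots> \<le> b ^ n" using that x by (intro power_increasing) (auto simp: b_def)
      finally show ?thesis using a by (simp add: le_divide_eq)
    qed
  qed
  thus ?thesis by (simp add: a_def)
qed

section \<open>Asymptotics and the three statements\<close>

text \<open>A single vertex is a path. This settles those \<open>k\<close> for which
  \<open>c\<close> is so small that the required length is not positive.\<close>

lemma random_subgraph_has_path_from_0:
  assumes "finite_graph G"
  shows "measure_pmf.prob (random_subgraph G p) {H. \<not> has_path_from H (verts G) 0} = 0"
proof -
  obtain v where v: "v \<in> verts G" using assms by (auto simp: finite_graph_def)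
  have "has_path_from (G\<lparr>edges := F\<rparr>) (verts G) 0" for F
    unfolding has_path_from_def using v by (intro exI[of _ "[v]"]) (simp add: is_path_def)
  thus ?thesis by (simp add: random_subgraph_def measure_map_pmf vimage_def)
qed

lemma asymptotically_almost_surely_if_failure_tendsto_0:
  assumes "eventually (\<lambda>k. measure_pmf.prob (M k) {x. \<not> P k x} \<le> h k) sequentially"
    and "h \<longlonglongrightarrow> 0"
  shows "asymptotically_almost_surely M P"
proof -
  have "(\<lambda>k. measure_pmf.prob (M k) {x. \<not> P k x}) \<longlonglongrightarrow> 0"
    by (rule tendsto_sandwich[OF _ assms(1) tendsto_const assms(2)]) simp
  from tendsto_diff[OF tendsto_const[of 1] this]
  have "(\<lambda>k. 1 - measure_pmf.prob (M k) {x. \<not> P k x}) \<longlonglongrightarrow> 1" by simp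
  moreover have "measure_pmf.prob (M k) {x. P k x} = 1 - measure_pmf.prob (M k) {x. \<not> P k x}" for k
    using measure_pmf.prob_compl[of "{x. \<not> P k x}" "M k"] by (simp add: Diff_eq Collect_neg_eq[symmetric])
  ultimately show ?thesis by (simp add: asymptotically_almost_surely_def)
qed

lemma powr_minus_half: "0 < (c::real) \<Longrightarrow> a * c powr (-1/2) = a / sqrt c"
  by (simp add: powr_minus_divide powr_half_sqrt)

lemma chernoff_bound_tendsto_0:
  fixes c :: "nat \<Rightarrow> real"
  assumes "\<And>k. c k > 0" "c \<in> o(\<lambda>k. real k)"
  shows "(\<lambda>k. exp (4 - real k / (2 * c k))) \<longlonglongrightarrow> 0"
proof -
  have "(\<lambda>k. 2 * (c k / real k)) \<longlonglongrightarrow> 0"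
    using smalloD_tendsto[OF assms(2)] by (intro tendsto_mult_right_zero)
  \<comment> \<open>The reciprocal tends to \<open>+\<infinity>\<close> only if the quotient is
    positive; at \<open>k = 0\<close> it is 0.\<close>
  moreover have "eventually (\<lambda>k. 0 < 2 * (c k / real k)) sequentially"
    using eventually_gt_at_top[of 0] by eventually_elim (use assms(1) in simp)
  ultimately have "filterlim (\<lambda>k. inverse (2 * (c k / real k))) at_top sequentially"
    by (rule filterlim_inverse_at_top)
  hence "filterlim (\<lambda>k. real k / (2 * c k)) at_top sequentially"
    by (simp add: field_simps)
  hence "((\<lambda>k. exp (- (real k / (2 * c k)))) \<longlongrightarrow> 0) sequentially"
    by (intro filterlim_compose[OF exp_at_bot]) (simp add: filterlim_uminus_at_top)
  hence "((\<lambda>k. exp 4 * exp (- (real k / (2 * c k)))) \<longlongrightarrow> 0) sequentially"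
    by (rule tendsto_mult_right_zero)
  thus ?thesis by (simp add: exp_add[symmetric])
qed

lemma inverse_sqrt_tendsto_0:
  fixes c :: "nat \<Rightarrow> real"
  assumes "filterlim c at_top sequentially"
  shows "(\<lambda>k. 1 / sqrt (1 + c k / 4)) \<longlonglongrightarrow> 0"
proof -
  have "filterlim (\<lambda>k. 1 / 4 * c k) at_top sequentially"
    by (rule filterlim_tendsto_pos_mult_at_top[OF tendsto_const _ assms]) simp
  hence "filterlim (\<lambda>k. sqrt (1 + 1 / 4 * c k)) at_top sequentially"
    by (intro filterlim_compose[OF sqrt_at_top] filterlim_tendsto_add_at_top[OF tendsto_const])
  hence "(\<lambda>k. inverse (sqrt (1 + 1 / 4 * c k))) \<longlonglongrightarrow> 0"
    by (rule tendsto_inverse_0_at_top)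
  thus ?thesis by (simp add: inverse_eq_divide)
qed

theorem theorem3p1:
  fixes c p :: "nat \<Rightarrow> real" and G :: "nat \<Rightarrow> 'a graph"
  assumes c_pos: "\<And>k. c k > 0"
    and c_small: "c \<in> o(\<lambda>k. real k)"
    and p_def: "\<And>k. p k = c k / real k"
    and graph: "\<And>k. finite_graph (G k)"
    and min_deg: "\<And>k. min_degree (G k) \<ge> k"
  shows "asymptotically_almost_surely (\<lambda>k. random_subgraph (G k) (p k))
           (\<lambda>k H. \<exists>xs. is_path H xs \<and>
              real (path_length xs) \<ge> (1 - 2 * c k powr (-1/2)) * real k) \<and>
         ((\<forall>k. bipartite (G k)) \<longrightarrow>
         asymptotically_almost_surely (\<lambda>k. random_subgraph (G k) (p k))
           (\<lambda>k H. \<exists>xs. is_path H xs \<and>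
              real (path_length xs) \<ge> (2 - 6 * c k powr (-1/2)) * real k)) \<and>
         (filterlim c at_top sequentially \<longrightarrow>
         (\<forall>v. (\<forall>k. v k \<in> verts (G k)) \<longrightarrow>
           asymptotically_almost_surely (\<lambda>k. random_subgraph (G k) (p k))
             (\<lambda>k H. \<exists>xs. is_path H xs \<and> hd xs = v k \<and>
                real (path_length xs) \<ge> (1 - 2 * c k powr (-1/2)) * real k)))"
proof -
  \<comment> \<open>This makes \<open>p k \<le> 1\<close>, so that \<open>bernoulli_pmf\<close> does
    not clamp it.\<close>
  have c_le: "eventually (\<lambda>k. c k \<le> real k) sequentially"
  proof -
    have "eventually (\<lambda>k. norm (c k) \<le> 1 * norm (real k)) sequentially"
      by (rule landau_o.smallD[OF c_small]) simp
    thus ?thesis by eventually_elim (use c_pos in simp)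
  qed
  note exp_0 = chernoff_bound_tendsto_0[OF c_pos c_small]
  have trivial: "measure_pmf.prob (random_subgraph (G k) (p k)) {H. \<not> has_path_from H (verts (G k)) (nat \<lceil>x\<rceil>)} \<le> exp y"
    if "x \<le> 0" for k x y
  proof -
    have "nat \<lceil>x\<rceil> = 0" using that by simp
    thus ?thesis using random_subgraph_has_path_from_0[OF graph] by simp
  qed
  have weaken: "measure_pmf.prob M {H. \<not> P H} \<le> h"
    if "measure_pmf.prob M {H. \<not> Q H} \<le> h" "\<And>H. Q H \<Longrightarrow> P H"
    for M :: "'a graph pmf" and P Q h
    using measure_pmf.finite_measure_mono[of "{H. \<not> P H}" "{H. \<not> Q H}" M] that
    by (auto intro: order_trans)
  have "asymptotically_almost_surely (\<lambda>k. random_subgraph (G k) (p k))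
           (\<lambda>k H. \<exists>xs. is_path H xs \<and>
              real (path_length xs) \<ge> (1 - 2 * c k powr (-1/2)) * real k)"
  proof (rule asymptotically_almost_surely_if_failure_tendsto_0[OF _ exp_0])
    show "eventually (\<lambda>k. measure_pmf.prob (random_subgraph (G k) (p k))
        {H. \<not> (\<exists>xs. is_path H xs \<and> real (path_length xs) \<ge> (1 - 2 * c k powr (-1/2)) * real k)}
        \<le> exp (4 - real k / (2 * c k))) sequentially"
      using c_le
    proof eventually_elim
      case (elim k)
      have "measure_pmf.prob (random_subgraph (G k) (p k))
          {H. \<not> has_path_from H (verts (G k)) (nat \<lceil>(1 - 2 / sqrt (c k)) * real k\<rceil>)}
          \<le> exp (4 - real k / (2 * c k))"
      \<comment> \<open>The split is made for each \<open>k\<close> separately, as \<open>c\<close>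
        may oscillate. Below 4 the required length is at most 0.\<close>
      proof (cases "4 \<le> c k")
        case True
        thus ?thesis using prob_no_path_le[OF graph min_deg True elim] by (simp add: p_def)
      next
        case False
        hence "sqrt (c k) \<le> 2" using real_sqrt_le_mono[of "c k" 4] by simp
        hence "1 - 2 / sqrt (c k) \<le> 0" using c_pos[of k] by (simp add: le_divide_eq)
        thus ?thesis by (intro trivial mult_nonpos_nonneg) auto
      qed
      thus ?case
        unfolding powr_minus_half[OF c_pos]
        by (rule weaken) (auto simp: has_path_from_def nat_ceiling_le_eq)
    qed
  qed
  moreover have "asymptotically_almost_surely (\<lambda>k. random_subgraph (G k) (p k))
           (\<lambda>k H. \<exists>xs. is_path H xs \<and>
              real (path_length xs) \<ge> (2 - 6 * c k powr (-1/2)) * real k)"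
    if bip: "\<forall>k. bipartite (G k)"
  proof (rule asymptotically_almost_surely_if_failure_tendsto_0[OF _ exp_0])
    show "eventually (\<lambda>k. measure_pmf.prob (random_subgraph (G k) (p k))
        {H. \<not> (\<exists>xs. is_path H xs \<and> real (path_length xs) \<ge> (2 - 6 * c k powr (-1/2)) * real k)}
        \<le> exp (4 - real k / (2 * c k))) sequentially"
      using c_le
    proof eventually_elim
      case (elim k)
      have "measure_pmf.prob (random_subgraph (G k) (p k))
          {H. \<not> has_path_from H (verts (G k)) (nat \<lceil>(2 - 6 / sqrt (c k)) * real k\<rceil>)}
          \<le> exp (4 - real k / (2 * c k))"
      \<comment> \<open>Here \<open>2 - 6 / sqrt (c k)\<close> changes sign at 9.\<close>
      proof (cases "9 \<le> c k")
        case True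
        thus ?thesis
          using bipartite_prob_no_path_le[OF graph min_deg bip[rule_format] True elim] by (simp add: p_def)
      next
        case False
        hence "sqrt (c k) \<le> 3" using real_sqrt_le_mono[of "c k" 9] by simp
        hence "2 - 6 / sqrt (c k) \<le> 0" using c_pos[of k] by (simp add: le_divide_eq)
        thus ?thesis by (intro trivial mult_nonpos_nonneg) auto
      qed
      thus ?case
        unfolding powr_minus_half[OF c_pos]
        by (rule weaken) (auto simp: has_path_from_def nat_ceiling_le_eq)
    qed
  qed
  moreover have "asymptotically_almost_surely (\<lambda>k. random_subgraph (G k) (p k))
             (\<lambda>k H. \<exists>xs. is_path H xs \<and> hd xs = v k \<and>
                real (path_length xs) \<ge> (1 - 2 * c k powr (-1/2)) * real k)"
    if c_large: "filterlim c at_top sequentially" and v: "\<forall>k. v k \<in> verts (G k)" for v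
  proof (rule asymptotically_almost_surely_if_failure_tendsto_0)
    show "eventually (\<lambda>k. measure_pmf.prob (random_subgraph (G k) (p k))
        {H. \<not> (\<exists>xs. is_path H xs \<and> hd xs = v k \<and>
              real (path_length xs) \<ge> (1 - 2 * c k powr (-1/2)) * real k)}
        \<le> exp (4 - real k / (2 * c k)) + 1 / sqrt (1 + c k / 4)) sequentially"
      using c_le c_large[unfolded filterlim_at_top, rule_format, of 12]
    proof eventually_elim
      case (elim k)
      show ?case
        using prob_no_path_from_vertex_le[OF graph min_deg v[rule_format] elim(2,1)]
        unfolding p_def powr_minus_half[OF c_pos]
        by (rule weaken) (auto simp: has_path_from_def nat_ceiling_le_eq)
    qed
    show "(\<lambda>k. exp (4 - real k / (2 * c k)) + 1 / sqrt (1 + c k / 4)) \<longlonglongrightarrow> 0"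
      using tendsto_add[OF exp_0 inverse_sqrt_tendsto_0[OF c_large]] by simp
  qed
  ultimately show ?thesis by blast
qed

end
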